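(* Let $\widetilde B$ and $\widetilde{EB}$ denote the polytopes obtained by projecting the LP relaxations of the Basic and Extended Basic formulations (defined in the context), respectively, onto the $\delta$-variable space. Then $\widetilde{EB}\subsetneq\widetilde B$. As a consequence, the Basic formulation is not integral in the $\delta$-space.
   Context: A polytope is called integral if all of its vertices are integer-valued; that a formulation is integral in the $\delta$-space means that the projection of its LP relaxation onto the $\delta$-variables is an integral polytope. The data are $T$ observations $(x_t,y_t)\in\mathbb{R}^2$, $t=1,\ldots,T$, with $x_1<x_2<\cdots<x_T$, to be fitted by a piecewise linear function with $K$ segments. Both formulations are mixed-integer programs minimizing $\sum_{t=1}^T|y_t-\hat y_t|^q$ with $q\in\{1,2\}$. In their LP relaxations the binary variables $\delta_{j,t}$ and $X_{j,t}$ are replaced by $\widetilde\delta_{j,t}\in[0,1]$ and $\widetilde X_{j,t}\in[0,1]$. Data-driven constants. Set $$L^m=\min_{t_1\ne t_2}\frac{y_{t_1}-y_{t_2}}{x_{t_1}-x_{t_2}},\qquad U^m=\max_{t_1\ne t_2}\frac{y_{t_1}-y_{t_2}}{x_{t_1}-x_{t_2}},$$ $$L^c=\min_t\min\{y_t-L^mx_t,\;y_t-U^mx_t\},\qquad U^c=\max_t\max\{y_t-L^mx_t,\;y_t-U^mx_t\},$$ and for $t=1,\ldots,T$ $$M^A_{1,t}=\max\{|L^mx_t|+|L^c|,\ |U^mx_t|+|L^c|,\ |L^mx_t|+|U^c|,\ |U^mx_t|+|U^c|\},\quad M^A_{2,t}=x_t-x_1,\quad M^A_{3,t}=x_T-x_t.$$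 LP relaxation of the Basic formulation. Variables: $\widetilde\delta_{j,t}\in[0,1]$, $m_j\in[L^m,U^m]$, $c_j\in[L^c,U^c]$ for $j=1,\ldots,K$, $t=1,\ldots,T$; breakpoints $r_0,\ldots,r_K\in\mathbb{R}$; fitted values $\hat y_1,\ldots,\hat y_T\in\mathbb{R}$. Constraints: (i) $\sum_{j=1}^K\widetilde\delta_{j,t}=1$ for all $t=1,\ldots,T$; (ii) $m_jx_t+c_j\le\hat y_t+M^A_{1,t}(1-\widetilde\delta_{j,t})$ and $m_jx_t+c_j\ge\hat y_t-M^A_{1,t}(1-\widetilde\delta_{j,t})$ for all $j=1,\ldots,K$, $t=1,\ldots,T$; (iii) $x_t\le r_j+M^A_{2,t}(1-\widetilde\delta_{j,t})$ and $x_t\ge r_{j-1}-M^A_{3,t}(1-\widetilde\delta_{j,t})$ for all $j=1,\ldots,K$, $t=1,\ldots,T$; (iv) $r_0=x_1$, $r_K=x_T$, and $r_j\le r_{j+1}$ for $j=0,\ldots,K-1$; (v) optionally (only if continuity of the fitted function is to be enforced), $m_jr_j+c_j=m_{j+1}r_j+c_{j+1}$ for $j=1,\ldots,K-1$. LP relaxation of the Extended Basic formulation. The same variables together with additional variables $\widetilde X_{j,t}\in[0,1]$ for $j=1,\ldots,K-1$, $t=1,\ldots,T$. All constraints other than (i) are kept unchanged, and (i) is replaced by (i') $\widetilde\delta_{1,t}=\widetilde X_{1,t}$, $\ \widetilde\delta_{j,t}=\widetilde X_{j,t}-\widetilde X_{j-1,t}$ for $j=2,\ldots,K-1$, and $\widetilde\delta_{K,t}=1-\widetilde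 X_{K-1,t}$, for all $t=1,\ldots,T$; $\ \widetilde X_{j,t}\ge\widetilde X_{j,t+1}$ for $j=1,\ldots,K-1$, $t=1,\ldots,T-1$; $\ \widetilde X_{j+1,t}\ge\widetilde X_{j,t}$ for $j=1,\ldots,K-2$, $t=1,\ldots,T$.
   Formalization: Proved for K ≥ 2 segments and T ≥ 2 observations, except K = T = 2: there both projections equal the integral triangle 0 ≤ δ_{1,2} ≤ δ_{1,1} ≤ 1, so the claim fails; for K = 1 or T = 1 the formulations are not well defined. *)

theory Defs
  imports "HOL-Analysis.Analysis"
begin

text \<open>
  Observations are indexed by \<open>1..T\<close> and segments by \<open>1..K\<close>, as natural numbers; values of the
  indexed families outside these ranges are irrelevant.
\<close>

definition slopes :: "nat \<Rightarrow> (nat \<Rightarrow> real) \<Rightarrow> (nat \<Rightarrow> real) \<Rightarrow> real set" where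
  "slopes T x y = {(y s - y t) / (x s - x t) | s t. s \<in> {1..T} \<and> t \<in> {1..T} \<and> s \<noteq> t}"

definition Lm :: "nat \<Rightarrow> (nat \<Rightarrow> real) \<Rightarrow> (nat \<Rightarrow> real) \<Rightarrow> real" where
  "Lm T x y = Min (slopes T x y)"

definition Um :: "nat \<Rightarrow> (nat \<Rightarrow> real) \<Rightarrow> (nat \<Rightarrow> real) \<Rightarrow> real" where
  "Um T x y = Max (slopes T x y)"

definition Lc :: "nat \<Rightarrow> (nat \<Rightarrow> real) \<Rightarrow> (nat \<Rightarrow> real) \<Rightarrow> real" where
  "Lc T x y = Min ((\<lambda>t. min (y t - Lm T x y * x t) (y t - Um T x y * x t)) ` {1..T})"

definition Uc :: "nat \<Rightarrow> (nat \<Rightarrow> real) \<Rightarrow> (nat \<Rightarrow> real) \<Rightarrow> real" where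
  "Uc T x y = Max ((\<lambda>t. max (y t - Lm T x y * x t) (y t - Um T x y * x t)) ` {1..T})"

definition M1 :: "nat \<Rightarrow> (nat \<Rightarrow> real) \<Rightarrow> (nat \<Rightarrow> real) \<Rightarrow> nat \<Rightarrow> real" where
  "M1 T x y t = Max {\<bar>Lm T x y * x t\<bar> + \<bar>Lc T x y\<bar>, \<bar>Um T x y * x t\<bar> + \<bar>Lc T x y\<bar>,
                     \<bar>Lm T x y * x t\<bar> + \<bar>Uc T x y\<bar>, \<bar>Um T x y * x t\<bar> + \<bar>Uc T x y\<bar>}"

definition M2 :: "(nat \<Rightarrow> real) \<Rightarrow> nat \<Rightarrow> real" where
  "M2 x t = x t - x 1"

definition M3 :: "nat \<Rightarrow> (nat \<Rightarrow> real) \<Rightarrow> nat \<Rightarrow> real" where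
  "M3 T x t = x T - x t"

text \<open>
  The constraints shared by the two relaxations, including the variable bounds. The flag \<open>cont\<close>
  says whether continuity of the fitted function is enforced.
\<close>

definition common_constraints ::
  "bool \<Rightarrow> nat \<Rightarrow> nat \<Rightarrow> (nat \<Rightarrow> real) \<Rightarrow> (nat \<Rightarrow> real) \<Rightarrow> (nat \<Rightarrow> nat \<Rightarrow> real) \<Rightarrow>
   (nat \<Rightarrow> real) \<Rightarrow> (nat \<Rightarrow> real) \<Rightarrow> (nat \<Rightarrow> real) \<Rightarrow> (nat \<Rightarrow> real) \<Rightarrow> bool" where
  "common_constraints cont K T x y \<delta> m c r yh \<longleftrightarrow>
     (\<forall>j\<in>{1..K}. \<forall>t\<in>{1..T}. \<delta> j t \<in> {0..1}) \<and>
     (\<forall>j\<in>{1..K}. m j \<in> {Lm T x y..Um T x y} \<and> c j \<in> {Lc T x y..Uc T x y}) \<and>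
     (\<forall>j\<in>{1..K}. \<forall>t\<in>{1..T}.
        m j * x t + c j \<le> yh t + M1 T x y t * (1 - \<delta> j t) \<and>
        m j * x t + c j \<ge> yh t - M1 T x y t * (1 - \<delta> j t)) \<and>
     (\<forall>j\<in>{1..K}. \<forall>t\<in>{1..T}.
        x t \<le> r j + M2 x t * (1 - \<delta> j t) \<and>
        x t \<ge> r (j - 1) - M3 T x t * (1 - \<delta> j t)) \<and>
     r 0 = x 1 \<and> r K = x T \<and> (\<forall>j<K. r j \<le> r (j + 1)) \<and>
     (cont \<longrightarrow> (\<forall>j\<in>{1..K - 1}. m j * r j + c j = m (j + 1) * r j + c (j + 1)))"

definition basic_lp ::
  "bool \<Rightarrow> nat \<Rightarrow> nat \<Rightarrow> (nat \<Rightarrow> real) \<Rightarrow> (nat \<Rightarrow> real) \<Rightarrow> (nat \<Rightarrow> nat \<Rightarrow> real) \<Rightarrow>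
   (nat \<Rightarrow> real) \<Rightarrow> (nat \<Rightarrow> real) \<Rightarrow> (nat \<Rightarrow> real) \<Rightarrow> (nat \<Rightarrow> real) \<Rightarrow> bool" where
  "basic_lp cont K T x y \<delta> m c r yh \<longleftrightarrow>
     common_constraints cont K T x y \<delta> m c r yh \<and>
     (\<forall>t\<in>{1..T}. (\<Sum>j = 1..K. \<delta> j t) = 1)"

text \<open>Meaningful for \<open>K \<ge> 2\<close> only: there are no variables \<open>X\<close> when \<open>K = 1\<close>.\<close>

definition extended_basic_lp ::
  "bool \<Rightarrow> nat \<Rightarrow> nat \<Rightarrow> (nat \<Rightarrow> real) \<Rightarrow> (nat \<Rightarrow> real) \<Rightarrow> (nat \<Rightarrow> nat \<Rightarrow> real) \<Rightarrow>
   (nat \<Rightarrow> real) \<Rightarrow> (nat \<Rightarrow> real) \<Rightarrow> (nat \<Rightarrow> real) \<Rightarrow> (nat \<Rightarrow> real) \<Rightarrow> (nat \<Rightarrow> nat \<Rightarrow> real) \<Rightarrow> bool" where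
  "extended_basic_lp cont K T x y \<delta> m c r yh X \<longleftrightarrow>
     common_constraints cont K T x y \<delta> m c r yh \<and>
     (\<forall>j\<in>{1..K - 1}. \<forall>t\<in>{1..T}. X j t \<in> {0..1}) \<and>
     (\<forall>t\<in>{1..T}.
        \<delta> 1 t = X 1 t \<and>
        (\<forall>j\<in>{2..K - 1}. \<delta> j t = X j t - X (j - 1) t) \<and>
        \<delta> K t = 1 - X (K - 1) t) \<and>
     (\<forall>j\<in>{1..K - 1}. \<forall>t\<in>{1..T - 1}. X j t \<ge> X j (t + 1)) \<and>
     (\<forall>j\<in>{1..K - 2}. \<forall>t\<in>{1..T}. X (j + 1) t \<ge> X j t)"

text \<open>
  The \<open>\<delta>\<close>-space is \<open>real ^ 't ^ 'k\<close> with \<open>K = CARD('k)\<close> and \<open>T = CARD('t)\<close>. For a finite type,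
  \<open>to_nat_on UNIV\<close> is a bijection onto \<open>{0..<CARD}\<close>, so \<open>delta_vec\<close> uses each entry with indices
  in \<open>{1..K}\<close> and \<open>{1..T}\<close> as exactly one coordinate.
\<close>

definition delta_vec :: "(nat \<Rightarrow> nat \<Rightarrow> real) \<Rightarrow> real ^ 't::finite ^ 'k::finite" where
  "delta_vec \<delta> =
     (\<chi> k t. \<delta> (to_nat_on (UNIV :: 'k set) k + 1) (to_nat_on (UNIV :: 't set) t + 1))"

definition basic_proj ::
  "bool \<Rightarrow> (nat \<Rightarrow> real) \<Rightarrow> (nat \<Rightarrow> real) \<Rightarrow> (real ^ 't::finite ^ 'k::finite) set" where
  "basic_proj cont x y =
     {delta_vec \<delta> | \<delta> m c r yh. basic_lp cont CARD('k) CARD('t) x y \<delta> m c r yh}"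

definition extended_basic_proj ::
  "bool \<Rightarrow> (nat \<Rightarrow> real) \<Rightarrow> (nat \<Rightarrow> real) \<Rightarrow> (real ^ 't::finite ^ 'k::finite) set" where
  "extended_basic_proj cont x y =
     {delta_vec \<delta> | \<delta> m c r yh X. extended_basic_lp cont CARD('k) CARD('t) x y \<delta> m c r yh X}"

definition integral_polytope :: "(real ^ 't::finite ^ 'k::finite) set \<Rightarrow> bool" where
  "integral_polytope P \<longleftrightarrow>
     polytope P \<and> (\<forall>v. v extreme_point_of P \<longrightarrow> (\<forall>k t. v $ k $ t \<in> \<int>))"

end

theory Submission
  imports Defs
begin

text \<open>
  Putting all segments on one common line and reading the fitted values off that line satisfies the
  fitting and continuity constraints for every \<open>\<delta>\<close>, so the shape of the projection comes from the
  breakpoints. Constraint (iii) says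
  \<open>r j \<ge> x 1 + (x t - x 1) * \<delta> j t\<close> and \<open>r (j - 1) \<le> x T - (x T - x t) * \<delta> j t\<close>, and
  monotone breakpoints within these bounds exist iff every lower bound that comes from a segment is
  at most every upper bound that comes from a later segment. So the projection
  of the Basic relaxation is cut out by finitely many linear inequalities in \<open>\<delta>\<close>
  (\<open>basic_lp_feasible_iff\<close>). It is a polytope even with continuity, although that constraint is
  bilinear in \<open>m\<close> and \<open>r\<close>.

  In the Extended Basic relaxation, \<open>X j t\<close> has to be the partial sum \<open>\<delta> 1 t + \<dots> + \<delta> j t\<close>, so it
  adds exactly the requirement that these partial sums do not increase with \<open>t\<close>
  (\<open>extended_basic_lp_iff\<close>). This gives the inclusion, and fractional points that move weight
  to an earlier segment as \<open>t\<close> grows make it strict (\<open>fractional_point_many_segments\<close>,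
  \<open>fractional_point_two_segments\<close>).

  At integral points the extra requirement is automatic
  (\<open>integral_region_point_cumulative_antimono\<close>), as the breakpoints forbid an
  observation to lie in an earlier segment than its predecessor. Hence, if all extreme points of the
  Basic projection were integral, they would all lie in the convex set \<open>EB\<close>, and so would their
  convex hull \<open>B\<close>, against the strictness of the inclusion.
\<close>

section \<open>Eliminating the auxiliary variables\<close>

text \<open>
  The last conjunct is what elimination of the breakpoints leaves: for \<open>i < j\<close>, the lower bound
  that \<open>\<delta> i s\<close> puts on \<open>r i\<close> must not exceed the upper bound that \<open>\<delta> j t\<close> puts on \<open>r (j - 1)\<close>.
\<close>

definition basic_region :: "nat \<Rightarrow> nat \<Rightarrow> (nat \<Rightarrow> real) \<Rightarrow> (nat \<Rightarrow> nat \<Rightarrow> real) \<Rightarrow> bool" where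
  "basic_region K T x \<delta> \<longleftrightarrow>
     (\<forall>j\<in>{1..K}. \<forall>t\<in>{1..T}. 0 \<le> \<delta> j t \<and> \<delta> j t \<le> 1) \<and>
     (\<forall>t\<in>{1..T}. (\<Sum>j = 1..K. \<delta> j t) = 1) \<and>
     (\<forall>j\<in>{1..K}. \<forall>i\<in>{1..<j}. \<forall>s\<in>{1..T}. \<forall>t\<in>{1..T}.
        (x s - x 1) * \<delta> i s + (x T - x t) * \<delta> j t \<le> x T - x 1)"

text \<open>
  The constraint \<open>X j t \<ge> X j (t + 1)\<close> with \<open>X j t\<close> written as a partial sum of \<open>\<delta>\<close>.
\<close>

definition cumulative_antimono :: "nat \<Rightarrow> nat \<Rightarrow> (nat \<Rightarrow> nat \<Rightarrow> real) \<Rightarrow> bool" where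
  "cumulative_antimono K T \<delta> \<longleftrightarrow>
     (\<forall>j\<in>{1..K - 1}. \<forall>t\<in>{1..T - 1}. (\<Sum>i = 1..j. \<delta> i (t + 1)) \<le> (\<Sum>i = 1..j. \<delta> i t))"

lemma slopes_finite_nonempty:
  assumes "T \<ge> 2"
  shows "finite (slopes T x y)" "slopes T x y \<noteq> {}"
proof -
  have "slopes T x y \<subseteq> (\<lambda>(s, t). (y s - y t) / (x s - x t)) ` ({1..T} \<times> {1..T})"
    unfolding slopes_def by auto
  then show "finite (slopes T x y)"
    by (rule finite_subset) simp
  have "(y 1 - y 2) / (x 1 - x 2) \<in> slopes T x y"
    unfolding slopes_def mem_Collect_eq
    by (rule exI[of _ 1], rule exI[of _ 2]) (use assms in auto)
  then show "slopes T x y \<noteq> {}" by blast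
qed

lemma Lm_le_Um: "T \<ge> 2 \<Longrightarrow> Lm T x y \<le> Um T x y"
  unfolding Lm_def Um_def using slopes_finite_nonempty by (metis Max_ge Min_in)

lemma Lc_le_Uc:
  assumes "T \<ge> 1"
  shows "Lc T x y \<le> Uc T x y"
proof -
  have "Lc T x y \<le> min (y 1 - Lm T x y * x 1) (y 1 - Um T x y * x 1)"
    unfolding Lc_def using assms by (intro Min_le) auto
  also have "\<dots> \<le> max (y 1 - Lm T x y * x 1) (y 1 - Um T x y * x 1)" by simp
  also have "\<dots> \<le> Uc T x y"
    unfolding Uc_def using assms by (intro Max_ge) auto
  finally show ?thesis .
qed

lemma M1_nonneg: "0 \<le> M1 T x y t"
  unfolding M1_def
  by (rule order_trans[OF _ Max_ge[of _ "\<bar>Lm T x y * x t\<bar> + \<bar>Lc T x y\<bar>"]]) auto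

text \<open>
  Chaining \<open>r i \<le> r (j - 1)\<close> with the lower bound on \<open>r i\<close> and the upper bound on \<open>r (j - 1)\<close>
  eliminates the breakpoints.
\<close>

lemma breakpoints_imp_crossing:
  assumes common: "common_constraints cont K T x y \<delta> m c r yh"
    and j: "j \<in> {1..K}" and i: "i \<in> {1..<j}" and s: "s \<in> {1..T}" and t: "t \<in> {1..T}"
  shows "(x s - x 1) * \<delta> i s + (x T - x t) * \<delta> j t \<le> x T - x 1"
proof -
  from common have mono: "\<And>l. l < K \<Longrightarrow> r l \<le> r (Suc l)"
    and lower: "x s \<le> r i + M2 x s * (1 - \<delta> i s)"
    and upper: "x t \<ge> r (j - 1) - M3 T x t * (1 - \<delta> j t)"
    using i j s t unfolding common_constraints_def by auto
  have "r i \<le> r l" if "i \<le> l" "l \<le> K" for l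
    using that by (induction rule: dec_induct) (auto intro: order_trans[OF _ mono])
  from this[of "j - 1"] have "r i \<le> r (j - 1)" using i j by auto
  then show ?thesis
    using lower upper unfolding M2_def M3_def by (simp add: algebra_simps)
qed

text \<open>
  The breakpoints are chosen as small as possible: \<open>r j\<close> is the largest lower bound that the
  segments up to \<open>j\<close> impose, so monotonicity is built in, and the upper bounds hold because each
  of them dominates each lower bound of an earlier segment.
\<close>

lemma basic_region_imp_basic_lp:
  assumes region: "basic_region K T x \<delta>" and K: "K \<ge> 1" and T: "T \<ge> 2"
    and x: "\<And>t. t \<in> {1..T} \<Longrightarrow> x 1 \<le> x t \<and> x t \<le> x T"
  shows "\<exists>m c r yh. basic_lp cont K T x y \<delta> m c r yh"
proof -
  \<comment> \<open>The lower bounds on \<open>r j\<close>; adding \<open>x 1\<close> gives \<open>r 0 = x 1\<close> and makes the set nonempty.\<close>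
  define low where
    "low j = insert (x 1) ((\<lambda>(i, s). x 1 + (x s - x 1) * \<delta> i s) ` ({1..j} \<times> {1..T}))" for j
  define r where "r j = (if j = K then x T else Max (low j))" for j
  have fin: "finite (low j)" "low j \<noteq> {}" for j
    unfolding low_def by auto
  have box: "0 \<le> \<delta> j t" "\<delta> j t \<le> 1" if "j \<in> {1..K}" "t \<in> {1..T}" for j t
    using region that unfolding basic_region_def by auto
  have low_le_end: "a \<le> x T" if "a \<in> low j" "j \<le> K" for a j
  proof -
    have "(x s - x 1) * \<delta> i s \<le> x T - x 1" if "i \<in> {1..j}" "s \<in> {1..T}" for i s
    proof -
      have "(x s - x 1) * \<delta> i s \<le> (x s - x 1) * 1"
        using box[of i s] x[of s] that \<open>j \<le> K\<close> by (intro mult_left_mono) auto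
      then show ?thesis using x[OF that(2)] by simp
    qed
    then show ?thesis
      using that x[of T] T unfolding low_def by fastforce
  qed
  have r0: "r 0 = x 1"
    using K unfolding r_def low_def by simp
  have r_mono: "r j \<le> r (j + 1)" if "j < K" for j
  proof (cases "j + 1 = K")
    case True
    then show ?thesis using low_le_end[of _ j] fin[of j] that unfolding r_def by simp
  next
    case False
    have "low j \<subseteq> low (j + 1)" unfolding low_def by force
    then show ?thesis using False that Max_mono[OF _ fin(2,1)] unfolding r_def by simp
  qed
  have r_ge: "x t \<le> r j + M2 x t * (1 - \<delta> j t)" if "j \<in> {1..K}" "t \<in> {1..T}" for j t
  proof (cases "j = K")
    case True
    have "0 \<le> M2 x t * (1 - \<delta> j t)"
      unfolding M2_def using box[OF that] x[OF that(2)] by simp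
    then show ?thesis using True x[OF that(2)] unfolding r_def by simp
  next
    case False
    have "x 1 + (x t - x 1) * \<delta> j t \<in> low j" unfolding low_def using that by force
    then have "x 1 + (x t - x 1) * \<delta> j t \<le> r j"
      using False fin unfolding r_def by simp
    then show ?thesis unfolding M2_def by (simp add: algebra_simps)
  qed
  have r_le: "x t \<ge> r (j - 1) - M3 T x t * (1 - \<delta> j t)" if "j \<in> {1..K}" "t \<in> {1..T}" for j t
  proof -
    have "a \<le> x T - (x T - x t) * \<delta> j t" if a: "a \<in> low (j - 1)" for a
    proof (cases "a = x 1")
      case True
      have "(x T - x t) * \<delta> j t \<le> (x T - x t) * 1"
        using box[of j t] x[of t] \<open>j \<in> _\<close> \<open>t \<in> _\<close> by (intro mult_left_mono) auto
      then show ?thesis using True x[OF \<open>t \<in> _\<close>] by simp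
    next
      case False
      then obtain i s where "i \<in> {1..j - 1}" "s \<in> {1..T}" "a = x 1 + (x s - x 1) * \<delta> i s"
        using a unfolding low_def by auto
      moreover from this have "i \<in> {1..<j}" by auto
      ultimately show ?thesis
        using region \<open>j \<in> _\<close> \<open>t \<in> _\<close> unfolding basic_region_def by fastforce
    qed
    then have "r (j - 1) \<le> x T - (x T - x t) * \<delta> j t"
      using fin that unfolding r_def by auto
    then show ?thesis unfolding M3_def by (simp add: algebra_simps)
  qed
  \<comment> \<open>On one common line every residual is zero and consecutive segments agree everywhere.\<close>
  have "basic_lp cont K T x y \<delta> (\<lambda>_. Lm T x y) (\<lambda>_. Lc T x y) r (\<lambda>t. Lm T x y * x t + Lc T x y)"
    unfolding basic_lp_def common_constraints_def
    using region r0 r_mono r_ge r_le box Lm_le_Um[OF T] Lc_le_Uc[of T] T M1_nonneg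
    by (auto simp: basic_region_def r_def)
  then show ?thesis by blast
qed

lemma basic_lp_feasible_iff:
  assumes "K \<ge> 1" "T \<ge> 2" "\<And>t. t \<in> {1..T} \<Longrightarrow> x 1 \<le> x t \<and> x t \<le> x T"
  shows "(\<exists>m c r yh. basic_lp cont K T x y \<delta> m c r yh) \<longleftrightarrow> basic_region K T x \<delta>"
proof
  assume "\<exists>m c r yh. basic_lp cont K T x y \<delta> m c r yh"
  then obtain m c r yh where lp: "basic_lp cont K T x y \<delta> m c r yh" by blast
  then have common: "common_constraints cont K T x y \<delta> m c r yh" by (simp add: basic_lp_def)
  then have "\<forall>j\<in>{1..K}. \<forall>t\<in>{1..T}. 0 \<le> \<delta> j t \<and> \<delta> j t \<le> 1"
    by (simp add: common_constraints_def)
  with lp breakpoints_imp_crossing[OF common] show "basic_region K T x \<delta>"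
    unfolding basic_region_def basic_lp_def by blast
qed (use basic_region_imp_basic_lp assms in blast)

text \<open>
  The linking constraints form a telescoping sum: they force \<open>X j t\<close> to be the partial sum of the
  first \<open>j\<close> entries and the total to be 1. Conversely the partial sums satisfy every
  constraint on \<open>X\<close> except monotonicity in \<open>t\<close>, because the entries are nonnegative.
\<close>

lemma extended_basic_lp_iff:
  assumes K: "K \<ge> 2"
  shows "(\<exists>X. extended_basic_lp cont K T x y \<delta> m c r yh X) \<longleftrightarrow>
    basic_lp cont K T x y \<delta> m c r yh \<and> cumulative_antimono K T \<delta>"
proof
  assume "\<exists>X. extended_basic_lp cont K T x y \<delta> m c r yh X"
  then obtain X where common: "common_constraints cont K T x y \<delta> m c r yh"
    and first: "\<And>t. t \<in> {1..T} \<Longrightarrow> \<delta> 1 t = X 1 t"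
    and diff: "\<And>j t. j \<in> {2..K - 1} \<Longrightarrow> t \<in> {1..T} \<Longrightarrow> \<delta> j t = X j t - X (j - 1) t"
    and last: "\<And>t. t \<in> {1..T} \<Longrightarrow> \<delta> K t = 1 - X (K - 1) t"
    and anti: "\<And>j t. j \<in> {1..K - 1} \<Longrightarrow> t \<in> {1..T - 1} \<Longrightarrow> X j (t + 1) \<le> X j t"
    unfolding extended_basic_lp_def by auto
  have X: "(\<Sum>i = 1..j. \<delta> i t) = X j t" if "1 \<le> j" "j \<le> K - 1" "t \<in> {1..T}" for j t
    using that
  proof (induction j rule: dec_induct)
    case base
    then show ?case using first by simp
  next
    case (step n)
    then show ?case using diff[of "Suc n" t] by simp
  qed
  have "(\<Sum>j = 1..K. \<delta> j t) = 1" if "t \<in> {1..T}" for t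
  proof -
    have "(\<Sum>j = 1..K. \<delta> j t) = (\<Sum>j = 1..K - 1. \<delta> j t) + \<delta> K t"
      using K sum.cl_ivl_Suc[of "\<lambda>j. \<delta> j t" 1 "K - 1"] by simp
    then show ?thesis using X[of "K - 1" t] last[OF that] that K by simp
  qed
  moreover have "cumulative_antimono K T \<delta>"
    unfolding cumulative_antimono_def using anti X by auto
  ultimately show "basic_lp cont K T x y \<delta> m c r yh \<and> cumulative_antimono K T \<delta>"
    using common unfolding basic_lp_def by blast
next
  assume *: "basic_lp cont K T x y \<delta> m c r yh \<and> cumulative_antimono K T \<delta>"
  define X where "X j t = (\<Sum>i = 1..j. \<delta> i t)" for j t
  from * have common: "common_constraints cont K T x y \<delta> m c r yh"
    and total: "\<And>t. t \<in> {1..T} \<Longrightarrow> X K t = 1"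
    unfolding basic_lp_def X_def by auto
  have nonneg: "0 \<le> \<delta> j t" if "j \<in> {1..K}" "t \<in> {1..T}" for j t
    using common that unfolding common_constraints_def by auto
  have X_mono: "X i t \<le> X j t" if "i \<le> j" "j \<le> K" "t \<in> {1..T}" for i j t
    unfolding X_def using that nonneg by (intro sum_mono2) auto
  have X_diff: "\<delta> j t = X j t - X (j - 1) t" if "1 \<le> j" for j t
    using that unfolding X_def by (cases j) simp_all
  have "X j t \<in> {0..1}" if "j \<in> {1..K - 1}" "t \<in> {1..T}" for j t
    using X_mono[of 0 j t] X_mono[of j K t] total that by (auto simp: X_def)
  moreover have "X j (t + 1) \<le> X j t" if "j \<in> {1..K - 1}" "t \<in> {1..T - 1}" for j t
    using * that unfolding cumulative_antimono_def X_def by blast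
  moreover have "\<delta> 1 t = X 1 t" for t by (simp add: X_def)
  moreover have "\<delta> K t = 1 - X (K - 1) t" if "t \<in> {1..T}" for t
    using X_diff[of K t] total[OF that] K by simp
  ultimately have "extended_basic_lp cont K T x y \<delta> m c r yh X"
    unfolding extended_basic_lp_def using common X_diff X_mono by auto
  then show "\<exists>X. extended_basic_lp cont K T x y \<delta> m c r yh X" by blast
qed

section \<open>Coordinates\<close>

text \<open>
  A left inverse of \<open>delta_vec\<close> on the index ranges that matter, through which the inequalities
  on \<open>\<delta>\<close> become linear inequalities on the vector space. Segments and observations are
  counted from 1, whereas \<open>to_nat_on\<close> counts from 0.
\<close>

definition delta_entry :: "real ^ 't::finite ^ 'k::finite \<Rightarrow> nat \<Rightarrow> nat \<Rightarrow> real" where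
  "delta_entry v j t = v $ from_nat_into UNIV (j - 1) $ from_nat_into UNIV (t - 1)"

lemma index_less_card: "to_nat_on (UNIV :: 'a::finite set) a < CARD('a)"
  using bij_betw_apply[OF to_nat_on_finite[OF finite[of UNIV]], of a] by simp

lemma delta_vec_delta_entry: "delta_vec (delta_entry v) = v"
  unfolding delta_vec_def delta_entry_def by (simp add: vec_eq_iff countable_finite)

lemma delta_entry_delta_vec:
  assumes "j \<in> {1..CARD('k)}" "t \<in> {1..CARD('t)}"
  shows "delta_entry (delta_vec \<delta> :: real ^ 't::finite ^ 'k::finite) j t = \<delta> j t"
proof -
  have "to_nat_on (UNIV :: 'a::finite set) (from_nat_into UNIV (n - 1)) + 1 = n"
    if "n \<in> {1..CARD('a)}" for n
  proof -
    have "n - 1 \<in> to_nat_on (UNIV :: 'a set) ` UNIV"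
      using that bij_betw_imp_surj_on[OF to_nat_on_finite[OF finite[of "UNIV :: 'a set"]]] by auto
    then show ?thesis using that by auto
  qed
  from this[OF assms(1)] this[OF assms(2)] show ?thesis
    unfolding delta_vec_def delta_entry_def by simp
qed

lemma linear_delta_entry: "linear (\<lambda>v. delta_entry v j t)"
  by (rule linearI) (simp_all add: delta_entry_def)

lemma basic_region_cong:
  assumes "\<And>j t. j \<in> {1..K} \<Longrightarrow> t \<in> {1..T} \<Longrightarrow> \<delta> j t = \<delta>' j t"
  shows "basic_region K T x \<delta> = basic_region K T x \<delta>'"
proof -
  have "(\<Sum>j = 1..K. \<delta> j t) = (\<Sum>j = 1..K. \<delta>' j t)" if "t \<in> {1..T}" for t
    using that assms by (intro sum.cong) auto
  then show ?thesis unfolding basic_region_def using assms by simp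
qed

lemma cumulative_antimono_cong:
  assumes "\<And>j t. j \<in> {1..K} \<Longrightarrow> t \<in> {1..T} \<Longrightarrow> \<delta> j t = \<delta>' j t"
  shows "cumulative_antimono K T \<delta> = cumulative_antimono K T \<delta>'"
proof -
  have "(\<Sum>i = 1..j. \<delta> i t) = (\<Sum>i = 1..j. \<delta>' i t)" if "j \<in> {1..K - 1}" "t \<in> {1..T}" for j t
    using that assms by (intro sum.cong) auto
  note eq = this
  have "(\<Sum>i = 1..j. \<delta> i (t + 1)) \<le> (\<Sum>i = 1..j. \<delta> i t) \<longleftrightarrow>
      (\<Sum>i = 1..j. \<delta>' i (t + 1)) \<le> (\<Sum>i = 1..j. \<delta>' i t)"
    if "j \<in> {1..K - 1}" "t \<in> {1..T - 1}" for j t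
    using eq[of j t] eq[of j "t + 1"] that by auto
  then show ?thesis unfolding cumulative_antimono_def by simp
qed

lemma basic_region_delta_vec:
  "basic_region CARD('k) CARD('t) x (delta_entry (delta_vec \<delta> :: real ^ 't::finite ^ 'k::finite)) \<longleftrightarrow>
    basic_region CARD('k) CARD('t) x \<delta>"
  by (rule basic_region_cong) (rule delta_entry_delta_vec)

lemma cumulative_antimono_delta_vec:
  "cumulative_antimono CARD('k) CARD('t)
      (delta_entry (delta_vec \<delta> :: real ^ 't::finite ^ 'k::finite)) \<longleftrightarrow>
    cumulative_antimono CARD('k) CARD('t) \<delta>"
  by (rule cumulative_antimono_cong) (rule delta_entry_delta_vec)

lemma basic_proj_eq:
  assumes "CARD('t::finite) \<ge> 2"
    and "\<And>t. t \<in> {1..CARD('t)} \<Longrightarrow> x 1 \<le> x t \<and> x t \<le> x CARD('t)"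
  shows "(basic_proj cont x y :: (real ^ 't ^ 'k::finite) set) =
    {v. basic_region CARD('k) CARD('t) x (delta_entry v)}"
proof -
  have feasible: "(\<exists>m c r yh. basic_lp cont CARD('k) CARD('t) x y \<delta> m c r yh) \<longleftrightarrow>
      basic_region CARD('k) CARD('t) x \<delta>" for \<delta>
    using assms by (intro basic_lp_feasible_iff) auto
  have "basic_proj cont x y =
      {delta_vec \<delta> :: real ^ 't ^ 'k | \<delta>. basic_region CARD('k) CARD('t) x \<delta>}"
    unfolding basic_proj_def feasible[symmetric] by blast
  also have "\<dots> = {v. basic_region CARD('k) CARD('t) x (delta_entry v)}"
  proof (intro equalityI subsetI)
    fix v :: "real ^ 't ^ 'k" assume "v \<in> {v. basic_region CARD('k) CARD('t) x (delta_entry v)}"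
    then show "v \<in> {delta_vec \<delta> | \<delta>. basic_region CARD('k) CARD('t) x \<delta>}"
      by (metis (mono_tags, lifting) delta_vec_delta_entry mem_Collect_eq)
  next
    fix v :: "real ^ 't ^ 'k"
    assume "v \<in> {delta_vec \<delta> | \<delta>. basic_region CARD('k) CARD('t) x \<delta>}"
    then show "v \<in> {v. basic_region CARD('k) CARD('t) x (delta_entry v)}"
      using basic_region_delta_vec by blast
  qed
  finally show ?thesis .
qed

lemma extended_basic_proj_eq:
  assumes "CARD('t::finite) \<ge> 2" "CARD('k::finite) \<ge> 2"
    and "\<And>t. t \<in> {1..CARD('t)} \<Longrightarrow> x 1 \<le> x t \<and> x t \<le> x CARD('t)"
  shows "(extended_basic_proj cont x y :: (real ^ 't ^ 'k) set) =
    {v \<in> basic_proj cont x y. cumulative_antimono CARD('k) CARD('t) (delta_entry v)}"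
proof -
  have "(extended_basic_proj cont x y :: (real ^ 't ^ 'k) set) =
      {delta_vec \<delta> | \<delta> m c r yh.
        basic_lp cont CARD('k) CARD('t) x y \<delta> m c r yh \<and> cumulative_antimono CARD('k) CARD('t) \<delta>}"
    unfolding extended_basic_proj_def extended_basic_lp_iff[OF assms(2), symmetric] by blast
  also have "\<dots> = {v \<in> basic_proj cont x y. cumulative_antimono CARD('k) CARD('t) (delta_entry v)}"
    unfolding basic_proj_def
  proof (intro equalityI subsetI)
    fix v :: "real ^ 't ^ 'k"
    assume "v \<in> {delta_vec \<delta> | \<delta> m c r yh.
      basic_lp cont CARD('k) CARD('t) x y \<delta> m c r yh \<and> cumulative_antimono CARD('k) CARD('t) \<delta>}"
    then show "v \<in> {v \<in> {delta_vec \<delta> | \<delta> m c r yh. basic_lp cont CARD('k) CARD('t) x y \<delta> m c r yh}.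
        cumulative_antimono CARD('k) CARD('t) (delta_entry v)}"
      using cumulative_antimono_delta_vec by blast
  next
    fix v :: "real ^ 't ^ 'k"
    assume "v \<in> {v \<in> {delta_vec \<delta> | \<delta> m c r yh. basic_lp cont CARD('k) CARD('t) x y \<delta> m c r yh}.
        cumulative_antimono CARD('k) CARD('t) (delta_entry v)}"
    then show "v \<in> {delta_vec \<delta> | \<delta> m c r yh.
        basic_lp cont CARD('k) CARD('t) x y \<delta> m c r yh \<and> cumulative_antimono CARD('k) CARD('t) \<delta>}"
      using cumulative_antimono_delta_vec by blast
  qed
  finally show ?thesis .
qed

section \<open>Polytopes\<close>

text \<open>
  By Riesz representation a linear functional is an inner product, so its sublevel sets are
  half-spaces, empty or everything. The two-sided form covers the comparison of partial sums.
\<close>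

lemma polyhedron_linear_le:
  fixes f g :: "'a::euclidean_space \<Rightarrow> real"
  assumes "linear f" "linear g"
  shows "polyhedron {v. f v \<le> g v + b}"
proof -
  define h where "h v = f v - g v" for v
  have "linear h" unfolding h_def using assms by (rule linear_compose_sub)
  then have riesz: "h v = adjoint h 1 \<bullet> v" for v
    using adjoint_works[of h v 1] by (simp add: inner_commute)
  have "{v. f v \<le> g v + b} = {v. h v \<le> b}" by (auto simp: h_def)
  also have "\<dots> = {v. adjoint h 1 \<bullet> v \<le> b}" by (simp only: riesz)
  finally show ?thesis by (simp add: polyhedron_halfspace_le)
qed

lemma polyhedron_Ball:
  assumes "finite A" "\<And>a. a \<in> A \<Longrightarrow> polyhedron {v. P a v}"
  shows "polyhedron {v. \<forall>a\<in>A. P a v}"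
proof -
  have "{v. \<forall>a\<in>A. P a v} = \<Inter> ((\<lambda>a. {v. P a v}) ` A)" by auto
  then show ?thesis using assms by (auto intro!: polyhedron_Inter)
qed

lemma polyhedron_Conj:
  "polyhedron {v. P v} \<Longrightarrow> polyhedron {v. Q v} \<Longrightarrow> polyhedron {v. P v \<and> Q v}"
  by (simp add: Collect_conj_eq)

lemma linear_delta_entry_sum: "linear (\<lambda>v. \<Sum>i\<in>I. delta_entry v i t)"
  by (intro linear_compose_sum ballI linear_delta_entry)

lemma polyhedron_basic_region:
  "polyhedron {v :: real ^ 't::finite ^ 'k::finite. basic_region K T x (delta_entry v)}"
proof -
  have le: "polyhedron {v :: real ^ 't ^ 'k. f v \<le> b}" and ge: "polyhedron {v. b \<le> f v}"
    if "linear f" for f :: "real ^ 't ^ 'k \<Rightarrow> real" and b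
    using polyhedron_linear_le[OF that linear_zero, of b]
      polyhedron_linear_le[OF linear_zero that, of "- b"] by simp_all
  have crossing: "linear (\<lambda>v. a * delta_entry v i s + b * delta_entry v j t)" for a b i s j t
    by (rule linearI) (simp_all add: delta_entry_def algebra_simps)
  show ?thesis
    unfolding basic_region_def eq_iff[of "sum _ _"]
    by (intro polyhedron_Conj polyhedron_Ball le ge linear_delta_entry
        linear_delta_entry_sum crossing) auto
qed

lemma polyhedron_cumulative_antimono:
  "polyhedron {v :: real ^ 't::finite ^ 'k::finite. cumulative_antimono K T (delta_entry v)}"
  unfolding cumulative_antimono_def
  by (intro polyhedron_Ball)
    (use polyhedron_linear_le[OF linear_delta_entry_sum linear_delta_entry_sum, of _ _ _ _ 0] in auto)

lemma bounded_basic_region: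
  "bounded {v :: real ^ 't::finite ^ 'k::finite. basic_region CARD('k) CARD('t) x (delta_entry v)}"
proof -
  have "norm v \<le> CARD('k) * CARD('t)"
    if "basic_region CARD('k) CARD('t) x (delta_entry v)" for v :: "real ^ 't ^ 'k"
  proof -
    have entry: "\<bar>v $ k $ t\<bar> \<le> 1" for k t
    proof -
      have "v $ k $ t = delta_entry v (to_nat_on UNIV k + 1) (to_nat_on UNIV t + 1)"
        by (simp add: delta_entry_def countable_finite)
      with that index_less_card[of k] index_less_card[of t] show ?thesis
        unfolding basic_region_def by (force simp: Suc_le_eq)
    qed
    have "norm v \<le> (\<Sum>k\<in>UNIV. norm (v $ k))"
      unfolding norm_vec_def[of v] by (rule L2_set_le_sum) simp
    also have "\<dots> \<le> (\<Sum>k::'k\<in>UNIV. \<Sum>t::'t\<in>UNIV. \<bar>v $ k $ t\<bar>)"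
      by (intro sum_mono norm_le_l1_cart)
    also have "\<dots> \<le> (\<Sum>k::'k\<in>UNIV. \<Sum>t::'t\<in>UNIV. 1)"
      by (intro sum_mono entry)
    finally show ?thesis by simp
  qed
  then show ?thesis unfolding bounded_iff by blast
qed

section \<open>Integral and fractional points\<close>

text \<open>
  An integral point assigns each observation to one segment. If observation \<open>t + 1\<close> were in
  segment \<open>i\<close> and observation \<open>t\<close> in a segment \<open>l > i\<close>, the inequality for the pair would read
  \<open>(x (t + 1) - x 1) + (x T - x t) \<le> x T - x 1\<close>, that is \<open>x (t + 1) \<le> x t\<close>.
\<close>

lemma integral_region_point_cumulative_antimono:
  assumes region: "basic_region K T x \<delta>" and x: "strict_mono_on {1..T} x"
    and int: "\<And>j t. j \<in> {1..K} \<Longrightarrow> t \<in> {1..T} \<Longrightarrow> \<delta> j t \<in> \<int>"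
  shows "cumulative_antimono K T \<delta>"
  unfolding cumulative_antimono_def
proof (intro ballI)
  fix j t assume j: "j \<in> {1..K - 1}" and t: "t \<in> {1..T - 1}"
  have box: "0 \<le> \<delta> i s" "\<delta> i s \<le> 1" if "i \<in> {1..K}" "s \<in> {1..T}" for i s
    using region that unfolding basic_region_def by auto
  have zero_one: "\<delta> i s = 1" if "i \<in> {1..K}" "s \<in> {1..T}" "\<delta> i s \<noteq> 0" for i s
    using int[OF that(1,2)] box[OF that(1,2)] that(3) by (auto elim!: Ints_cases)
  have total: "(\<Sum>i = 1..j. \<delta> i s) + (\<Sum>i = j + 1..K. \<delta> i s) = 1" if "s \<in> {1..T}" for s
  proof -
    have "(\<Sum>i = 1..K. \<delta> i s) = 1" using region that unfolding basic_region_def by blast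
    then show ?thesis using sum.ub_add_nat[of 1 j "\<lambda>i. \<delta> i s" "K - j"] j by auto
  qed
  have tail: "0 \<le> (\<Sum>i = j + 1..K. \<delta> i (t + 1))"
    using t by (intro sum_nonneg box) auto
  have head: "0 \<le> (\<Sum>i = 1..j. \<delta> i t)"
    using j t by (intro sum_nonneg box) auto
  show "(\<Sum>i = 1..j. \<delta> i (t + 1)) \<le> (\<Sum>i = 1..j. \<delta> i t)"
  proof (cases "\<exists>i\<in>{1..j}. \<delta> i (t + 1) \<noteq> 0")
    case False
    then have "(\<Sum>i = 1..j. \<delta> i (t + 1)) = 0" by (intro sum.neutral) auto
    with head show ?thesis by linarith
  next
    case True
    then obtain i where i: "i \<in> {1..j}" "\<delta> i (t + 1) = 1"
      using zero_one[of _ "t + 1"] j t by fastforce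
    \<comment> \<open>Observation \<open>t\<close> cannot lie beyond segment \<open>j\<close>, so the partial sum at \<open>t\<close> is the whole sum 1.\<close>
    have "\<delta> l t = 0" if l: "l \<in> {j + 1..K}" for l
    proof (rule ccontr)
      assume "\<delta> l t \<noteq> 0"
      then have "\<delta> l t = 1" using zero_one[of l t] l t by auto
      moreover have "(x (t + 1) - x 1) * \<delta> i (t + 1) + (x T - x t) * \<delta> l t \<le> x T - x 1"
      proof -
        have "l \<in> {1..K}" "i \<in> {1..<l}" "t + 1 \<in> {1..T}" "t \<in> {1..T}"
          using l i t by auto
        then show ?thesis using region unfolding basic_region_def by blast
      qed
      moreover have "x t < x (t + 1)"
        using t by (intro strict_mono_onD[OF x]) auto
      ultimately show False using i(2) by simp
    qed
    then have "(\<Sum>l = j + 1..K. \<delta> l t) = 0"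
      by (intro sum.neutral) auto
    moreover have "t \<in> {1..T}" "t + 1 \<in> {1..T}" using t by auto
    ultimately show ?thesis using total[of t] total[of "t + 1"] tail by linarith
  qed
qed

text \<open>
  If no entry exceeds 1/2, every interior breakpoint may be placed at the midpoint of \<open>x 1\<close> and \<open>x T\<close>,
  so the breakpoints impose no order. With three segments there is room to split the first
  observation equally between segments 2 and 3 and all others between segments 1 and 2, which
  moves weight to an earlier segment.
\<close>

lemma fractional_point_many_segments:
  assumes K: "K \<ge> 3" and T: "T \<ge> 2"
    and x: "\<And>t. t \<in> {1..T} \<Longrightarrow> x 1 \<le> x t \<and> x t \<le> x T"
  shows "\<exists>\<delta>. basic_region K T x \<delta> \<and> \<not> cumulative_antimono K T \<delta>"
proof -
  define \<delta> :: "nat \<Rightarrow> nat \<Rightarrow> real" where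
    "\<delta> j t = (if j \<in> (if t = 1 then {2, 3} else {1, 2}) then 1 / 2 else 0)" for j t
  have box: "0 \<le> \<delta> j t" "\<delta> j t \<le> 1 / 2" for j t unfolding \<delta>_def by auto
  have "(\<Sum>j = 1..K. \<delta> j t) = 1" for t
  proof -
    have "(\<Sum>j = 1..K. \<delta> j t) = (\<Sum>j\<in>(if t = 1 then {2, 3} else {1, 2 :: nat}). 1 / 2)"
      unfolding \<delta>_def using K by (intro sum.mono_neutral_cong_right) auto
    then show ?thesis by (cases "t = 1") simp_all
  qed
  moreover have "(x s - x 1) * \<delta> i s + (x T - x t) * \<delta> j t \<le> x T - x 1"
    if "s \<in> {1..T}" "t \<in> {1..T}" for i j s t
  proof -
    have "(x s - x 1) * \<delta> i s \<le> (x T - x 1) * (1 / 2)"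
      using x[OF that(1)] box by (intro mult_mono) auto
    moreover have "(x T - x t) * \<delta> j t \<le> (x T - x 1) * (1 / 2)"
      using x[OF that(2)] box by (intro mult_mono) auto
    ultimately show ?thesis by simp
  qed
  ultimately have "basic_region K T x \<delta>"
    unfolding basic_region_def using box by (auto intro: order_trans[OF box(2)])
  moreover have "\<not> cumulative_antimono K T \<delta>"
  proof
    assume "cumulative_antimono K T \<delta>"
    then have "(\<Sum>i = 1..1. \<delta> i (1 + 1)) \<le> (\<Sum>i = 1..1. \<delta> i 1)"
      unfolding cumulative_antimono_def using K T by fastforce
    then show False by (simp add: \<delta>_def)
  qed
  ultimately show ?thesis by blast
qed

text \<open>
  With two segments the point with all entries 1/2 is tight, but only for the pair consisting of
  the first and the last observation. A third observation strictly between them leaves slack to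
  raise the weight that observation 2 gives to segment 1.
\<close>

lemma fractional_point_two_segments:
  assumes T: "T \<ge> 3" and x: "strict_mono_on {1..T} x"
  shows "\<exists>\<delta>. basic_region 2 T x \<delta> \<and> \<not> cumulative_antimono 2 T \<delta>"
proof -
  have ends: "x 1 \<le> x t" "x t \<le> x T" if "t \<in> {1..T}" for t
    using that T by (auto intro!: strict_mono_on_leD[OF x])
  have x12: "x 1 < x 2" and x2T: "x 2 < x T"
    using T by (auto intro!: strict_mono_onD[OF x])
  \<comment> \<open>The second bound is the slack for observation 2; the first keeps the weight at most 1.\<close>
  define e where "e = min (1 / 2) ((x T - x 2) / (2 * (x 2 - x 1)))"
  have e: "0 < e" "e \<le> 1 / 2" "(x 2 - x 1) * e \<le> (x T - x 2) / 2"
  proof -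
    show "0 < e" using x12 x2T by (simp add: e_def)
    show "e \<le> 1 / 2" unfolding e_def by (rule min.cobounded1)
    have "e \<le> (x T - x 2) / (2 * (x 2 - x 1))"
      unfolding e_def by (rule min.cobounded2)
    then show "(x 2 - x 1) * e \<le> (x T - x 2) / 2" using x12 by (simp add: field_simps)
  qed
  define p where "p t = 1 / 2 + (if t = 2 then e else 0)" for t :: nat
  define \<delta> where "\<delta> j t = (if j = 1 then p t else 1 - p t)" for j t :: nat
  have p: "1 / 2 \<le> p t" "p t \<le> 1" for t using e by (auto simp: p_def)
  have "(x s - x 1) * p s + (x T - x t) * (1 - p t) \<le> x T - x 1"
    if s: "s \<in> {1..T}" and t: "t \<in> {1..T}" for s t
  proof -
    have "(x s - x 1) * p s \<le> (x T - x 1) * (1 / 2)"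
      using e(3) ends[OF s] by (auto simp: p_def algebra_simps)
    moreover have "(x T - x t) * (1 - p t) \<le> (x T - x 1) * (1 / 2)"
      using ends[OF t] p[of t] by (intro mult_mono) auto
    ultimately show ?thesis by simp
  qed
  moreover have "{1..2::nat} = {1, 2}" by auto
  ultimately have "basic_region 2 T x \<delta>"
    unfolding basic_region_def using p by (auto simp: \<delta>_def intro: order_trans[OF _ p(1)])
  moreover have "\<not> cumulative_antimono 2 T \<delta>"
  proof
    assume "cumulative_antimono 2 T \<delta>"
    then have "(\<Sum>i = 1..1. \<delta> i (1 + 1)) \<le> (\<Sum>i = 1..1. \<delta> i 1)"
      unfolding cumulative_antimono_def using T by fastforce
    then show False using e(1) by (simp add: \<delta>_def p_def)
  qed
  ultimately show ?thesis by blast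
qed

theorem proposition2:
  fixes x y :: "nat \<Rightarrow> real"
    and cont :: bool
    and B EB :: "(real ^ 't::finite ^ 'k::finite) set"
  assumes "CARD('k) \<ge> 2" and "CARD('t) \<ge> 2"
    and "\<not> (CARD('k) = 2 \<and> CARD('t) = 2)"
    and "strict_mono_on {1..CARD('t)} x"
  defines "B \<equiv> basic_proj cont x y"
    and "EB \<equiv> extended_basic_proj cont x y"
  shows "polytope B \<and> polytope EB \<and> EB \<subset> B \<and> \<not> integral_polytope B"
proof -
  have x: "x 1 \<le> x t \<and> x t \<le> x CARD('t)" if "t \<in> {1..CARD('t)}" for t
    using that by (auto intro!: strict_mono_on_leD[OF assms(4)])
  have B: "B = {v. basic_region CARD('k) CARD('t) x (delta_entry v)}"
    unfolding B_def using assms(2) x by (rule basic_proj_eq)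
  have EB: "EB = {v \<in> B. cumulative_antimono CARD('k) CARD('t) (delta_entry v)}"
    unfolding EB_def B_def using assms(2,1) x by (rule extended_basic_proj_eq)
  have polyB: "polytope B"
    unfolding B polytope_eq_bounded_polyhedron
    using polyhedron_basic_region bounded_basic_region by blast
  have "polyhedron EB"
    unfolding EB B mem_Collect_eq
    by (intro polyhedron_Conj polyhedron_basic_region polyhedron_cumulative_antimono)
  moreover have "bounded EB"
    using polytope_imp_bounded[OF polyB] by (rule bounded_subset) (auto simp: EB)
  ultimately have polyEB: "polytope EB"
    unfolding polytope_eq_bounded_polyhedron by blast
  have "\<exists>\<delta>. basic_region CARD('k) CARD('t) x \<delta> \<and> \<not> cumulative_antimono CARD('k) CARD('t) \<delta>"
  proof (cases "CARD('k) = 2")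
    case True
    then show ?thesis using fractional_point_two_segments[of "CARD('t)" x] assms(2-4) by simp
  next
    case False
    then show ?thesis using assms(1,2) x by (intro fractional_point_many_segments) auto
  qed
  then obtain \<delta> where \<delta>: "basic_region CARD('k) CARD('t) x \<delta>"
      "\<not> cumulative_antimono CARD('k) CARD('t) \<delta>"
    by blast
  have "(delta_vec \<delta> :: real ^ 't ^ 'k) \<in> B - EB"
    using \<delta> basic_region_delta_vec cumulative_antimono_delta_vec unfolding EB B by blast
  then have strict: "EB \<subset> B" unfolding EB by blast
  have "\<not> integral_polytope B"
  proof
    assume int: "integral_polytope B"
    have "{v. v extreme_point_of B} \<subseteq> EB"
    proof
      fix v assume "v \<in> {v. v extreme_point_of B}"
      then have "v \<in> B" "\<And>j t. delta_entry v j t \<in> \<int>"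
        using int unfolding integral_polytope_def delta_entry_def extreme_point_of_def by auto
      then show "v \<in> EB"
        using integral_region_point_cumulative_antimono[OF _ assms(4)] unfolding EB B by blast
    qed
    then have "convex hull {v. v extreme_point_of B} \<subseteq> EB"
      using polytope_imp_convex[OF polyEB] by (rule hull_minimal)
    then have "B \<subseteq> EB"
      using Krein_Milman_Minkowski[OF polytope_imp_compact[OF polyB] polytope_imp_convex[OF polyB]]
      by simp
    with strict show False by blast
  qed
  with polyB polyEB strict show ?thesis by blast
qed

end
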